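(* For all positive integers $k,m,n$, $R(B_{k,m},S_n)\leq k+m+n-1$.
   Context: For graphs $G_1,G_2$, $R(G_1,G_2)$ is the least integer $N$ such that every red/blue edge-coloring of $K_N$ contains a red copy of $G_1$ or a blue copy of $G_2$. $S_n$ denotes the star with $n$ edges ($n+1$ vertices: one center of degree $n$ and $n$ leaves). $B_{k,m}$ denotes the bistar on $k+m$ vertices: a vertex $v$ of degree $k$, a vertex $w$ adjacent to $v$ of degree $m$, and $k+m-2$ further vertices of degree $1$ (the edge $vw$ is its spine). *)

theory Defs
  imports "HOL-Library.Ramsey"
begin

text \<open>A finite simple graph is a pair (vertex set, edge set), the edges being 2-element subsets of
  the vertex set.\<close>

type_synonym 'a graph = "'a set \<times> 'a set set"

definition simple_graph :: "'a graph \<Rightarrow> bool" where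
  "simple_graph G \<longleftrightarrow> finite (fst G) \<and> snd G \<subseteq> nsets (fst G) 2"

definition degree :: "'a graph \<Rightarrow> 'a \<Rightarrow> nat" where
  "degree G x = card {e \<in> snd G. x \<in> e}"

datatype colour = Red | Blue

text \<open>A 2-colouring of \<open>K\<^sub>N\<close> on the vertex set \<open>{..<N}\<close> is a function on sets; only
  its values on \<open>nsets {..<N} 2\<close> are relevant. A copy of a graph is a not necessarily
  induced subgraph isomorphic to it.\<close>

definition mono_copy :: "nat \<Rightarrow> (nat set \<Rightarrow> colour) \<Rightarrow> colour \<Rightarrow> 'a graph \<Rightarrow> bool" where
  "mono_copy N c i G \<longleftrightarrow>
     (\<exists>f. inj_on f (fst G) \<and> f ` fst G \<subseteq> {..<N} \<and> (\<forall>e \<in> snd G. c (f ` e) = i))"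

definition arrows :: "nat \<Rightarrow> 'a graph \<Rightarrow> 'b graph \<Rightarrow> bool" where
  "arrows N G H \<longleftrightarrow> (\<forall>c. mono_copy N c Red G \<or> mono_copy N c Blue H)"

definition ramsey_number :: "'a graph \<Rightarrow> 'b graph \<Rightarrow> nat" where
  "ramsey_number G H = (LEAST N. arrows N G H)"

text \<open>The star has centre 0 and leaves \<open>1, \<dots>, n\<close>.\<close>

definition star :: "nat \<Rightarrow> nat graph" where
  "star n = ({..n}, {{0, i} | i. i \<in> {1..n}})"

text \<open>The bistar has the spine \<open>{0, 1}\<close>; vertex 0 is also joined to the \<open>k - 1\<close> leaves
  \<open>2, \<dots>, k\<close> and vertex 1 to the \<open>m - 1\<close> leaves \<open>k + 1, \<dots>, k + m - 1\<close>. Both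
  \<open>k\<close> and \<open>m\<close> are meant to be positive.\<close>

definition bistar :: "nat \<Rightarrow> nat \<Rightarrow> nat graph" where
  "bistar k m = ({..<k + m},
     {{0, 1}} \<union> {{0, i} | i. i \<in> {2..k}} \<union> {{1, i} | i. i \<in> {k + 1..<k + m}})"

text \<open>The two concrete graphs have the intended orders and degrees.\<close>

lemma simple_graph_star: "simple_graph (star n)"
  by (auto simp: simple_graph_def star_def nsets_def)

lemma card_verts_star: "card (fst (star n)) = n + 1"
  by (simp add: star_def)

lemma degree_star_centre: "degree (star n) 0 = n"
proof -
  have "{e \<in> snd (star n). 0 \<in> e} = (\<lambda>i. {0, i}) ` {1..n}"
    by (auto simp: star_def)
  moreover have "inj_on (\<lambda>i. {0, i}) {1..n}"
    by (auto simp: inj_on_def doubleton_eq_iff)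
  ultimately show ?thesis
    by (simp add: degree_def card_image)
qed

lemma degree_star_leaf:
  assumes "i \<in> {1..n}"
  shows "degree (star n) i = 1"
proof -
  have "{e \<in> snd (star n). i \<in> e} = {{0, i}}"
    using assms by (auto simp: star_def)
  then show ?thesis
    by (simp add: degree_def)
qed

lemma simple_graph_bistar:
  assumes "k \<ge> 1" "m \<ge> 1"
  shows "simple_graph (bistar k m)"
  using assms by (auto simp: simple_graph_def bistar_def nsets_def card_insert_if)

lemma card_verts_bistar: "card (fst (bistar k m)) = k + m"
  by (simp add: bistar_def)

lemma degree_bistar_0:
  assumes "k \<ge> 1" "m \<ge> 1"
  shows "degree (bistar k m) 0 = k"
proof -
  have "{e \<in> snd (bistar k m). 0 \<in> e} = (\<lambda>i. {0, i}) ` {1..k}"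
  proof -
    have "{1..k} = insert 1 {2..k}"
      using assms by auto
    then show ?thesis
      by (auto simp: bistar_def)
  qed
  moreover have "inj_on (\<lambda>i. {0, i}) {1..k}"
    by (auto simp: inj_on_def doubleton_eq_iff)
  ultimately show ?thesis
    by (simp add: degree_def card_image)
qed

lemma degree_bistar_1:
  assumes "k \<ge> 1" "m \<ge> 1"
  shows "degree (bistar k m) 1 = m"
proof -
  have "{e \<in> snd (bistar k m). 1 \<in> e} = (\<lambda>i. {1, i}) ` insert 0 {k + 1..<k + m}"
    using assms by (auto simp: bistar_def)
  moreover have "inj_on (\<lambda>i. {1, i}) (insert 0 {k + 1..<k + m})"
    by (auto simp: inj_on_def doubleton_eq_iff)
  ultimately show ?thesis
    using assms by (simp add: degree_def card_image)
qed

lemma spine_bistar: "{0, 1} \<in> snd (bistar k m)"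
  by (simp add: bistar_def)

lemma degree_bistar_leaf:
  assumes "k \<ge> 1" "m \<ge> 1" "i \<in> {2..<k + m}"
  shows "degree (bistar k m) i = 1"
proof -
  have "{e \<in> snd (bistar k m). i \<in> e} = {if i \<le> k then {0, i} else {1, i}}"
    using assms by (auto simp: bistar_def)
  then show ?thesis
    by (simp add: degree_def)
qed

text \<open>Ramsey's theorem: the \<open>LEAST\<close> in the definition of the Ramsey number ranges over a
  nonempty set.\<close>

lemma arrows_exists:
  assumes "simple_graph G" "simple_graph H"
  shows "\<exists>N. arrows N G H"
proof -
  obtain N :: nat where N: "partn_lst {..<N} [card (fst G), card (fst H)] 2"
    using ramsey_full by blast
  have copy: "mono_copy N c i F"
    if F: "simple_graph F" and K: "K \<in> nsets {..<N} (card (fst F))"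
      and col: "\<And>e. e \<in> nsets K 2 \<Longrightarrow> c e = i"
    for c i K and F :: "'c graph"
  proof -
    have "finite (fst F)" "finite K" "card (fst F) = card K"
      using F K by (auto simp: simple_graph_def nsets_def)
    then obtain f where f: "bij_betw f (fst F) K"
      using finite_same_card_bij by blast
    have "c (f ` e) = i" if "e \<in> snd F" for e
    proof -
      have e: "e \<subseteq> fst F" "finite e" "card e = 2"
        using that F by (auto simp: simple_graph_def nsets_def)
      then have "f ` e \<in> nsets K 2"
        using f by (auto simp: nsets_def bij_betw_def card_image inj_on_subset)
      then show ?thesis
        by (rule col)
    qed
    then show ?thesis
      using f K by (auto simp: mono_copy_def bij_betw_def nsets_def)
  qed
  have "mono_copy N c Red G \<or> mono_copy N c Blue H" for c
  proof -
    define g where "g e = (if c e = Red then 0 else 1 :: nat)" for e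
    have "g \<in> nsets {..<N} 2 \<rightarrow> {..<2}"
      by (auto simp: g_def)
    then obtain j K where j: "j < 2"
      and K: "K \<in> nsets {..<N} ([card (fst G), card (fst H)] ! j)"
      and gK: "g ` nsets K 2 \<subseteq> {j}"
      using partn_lstE[OF N, of g 2] by (auto simp: numeral_2_eq_2)
    consider "j = 0" | "j = 1"
      using j by linarith
    then show ?thesis
    proof cases
      case 1
      then have "c e = Red" if "e \<in> nsets K 2" for e
        using gK that by (auto simp: g_def image_subset_iff split: if_splits)
      then show ?thesis
        using copy[OF assms(1), of K c Red] K 1 by simp
    next
      case 2
      then have "c e = Blue" if "e \<in> nsets K 2" for e
        using gK that by (cases "c e") (auto simp: g_def image_subset_iff)
      then show ?thesis
        using copy[OF assms(2), of K c Blue] K 2 by simp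
    qed
  qed
  then show ?thesis
    unfolding arrows_def by blast
qed

end

theory Submission
  imports Defs
begin

text \<open>If there is no blue \<open>S\<^sub>n\<close>, every vertex has at most \<open>n - 1\<close> blue neighbours, hence at
  least \<open>k + m - 1\<close> red ones. Take any red edge as the spine: each of its ends has at least
  \<open>k + m - 2\<close> further red neighbours, so \<open>k - 1\<close> leaves at one end and then \<open>m - 1\<close> other
  leaves at the other end can be chosen greedily.\<close>

text \<open>The vertex \<open>x\<close> is removed because \<open>{x, x}\<close> collapses to the
  singleton \<open>{x}\<close>, which is no edge although \<open>c\<close> has a value
  there.\<close>

definition nbhd :: "nat \<Rightarrow> (nat set \<Rightarrow> colour) \<Rightarrow> colour \<Rightarrow> nat \<Rightarrow> nat set" where
  "nbhd N c i x = {y \<in> {..<N} - {x}. c {x, y} = i}"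

lemma finite_nbhd [simp]: "finite (nbhd N c i x)"
  by (simp add: nbhd_def)

lemma card_nbhd_Red_plus_Blue:
  assumes "x < N"
  shows "card (nbhd N c Red x) + card (nbhd N c Blue x) = N - 1"
proof -
  have "nbhd N c Red x \<union> nbhd N c Blue x = {..<N} - {x}"
    by (auto simp: nbhd_def) (metis colour.exhaust)
  moreover have "nbhd N c Red x \<inter> nbhd N c Blue x = {}"
    by (auto simp: nbhd_def)
  ultimately show ?thesis
    using assms card_Un_disjoint[of "nbhd N c Red x" "nbhd N c Blue x"] by simp
qed

text \<open>Any \<open>n\<close> neighbours of \<open>x\<close> in colour \<open>i\<close> can serve
  as leaves, since a copy need not be induced and the edges among them may have any colour.\<close>

lemma mono_copy_star:
  assumes "x < N" and "n \<le> card (nbhd N c i x)"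
  shows "mono_copy N c i (star n)"
proof -
  obtain A where A: "A \<subseteq> nbhd N c i x" "card A = n"
    using obtain_subset_with_card_n[OF assms(2)] by metis
  then have "finite A"
    by (meson finite_nbhd finite_subset)
  then obtain g where g: "bij_betw g {1..n} A"
    using finite_same_card_bij[of "{1..n}" A] A by auto
  define f where "f j = (if j = 0 then x else g j)" for j
  have gA: "g j \<in> A" if "j \<in> {1..n}" for j
    using g that by (auto simp: bij_betw_def)
  have eq: "{..n} = insert 0 {1..n}"
    by auto
  have "bij_betw f {1..n} A"
    using g bij_betw_cong[of "{1..n}" f g A] by (simp add: f_def)
  then have "inj_on f {1..n}" "f ` {1..n} = A"
    by (auto simp: bij_betw_def)
  moreover have "f 0 = x" "x \<notin> A"
    using A by (auto simp: f_def nbhd_def)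
  ultimately have "inj_on f {..n}" "f ` {..n} = insert x A"
    unfolding eq by auto
  moreover have "insert x A \<subseteq> {..<N}"
    using A assms(1) by (auto simp: nbhd_def)
  moreover have "c (f ` {0, j}) = i" if "j \<in> {1..n}" for j
    using gA[OF that] that A by (auto simp: f_def nbhd_def insert_commute)
  ultimately show ?thesis
    unfolding mono_copy_def star_def by (intro exI[of _ f]) auto
qed

text \<open>The spine goes to \<open>{v, w}\<close>; the leaves \<open>A\<close> at \<open>v\<close>
  are chosen first, then the leaves \<open>B\<close> at \<open>w\<close> outside \<open>A\<close>,
  so that no vertex is used twice.\<close>

lemma mono_copy_bistar:
  assumes "k \<ge> 1" "m \<ge> 1" "v < N" and w: "w \<in> nbhd N c i v"
    and v_deg: "k + m - 1 \<le> card (nbhd N c i v)"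
    and w_deg: "k + m - 1 \<le> card (nbhd N c i w)"
  shows "mono_copy N c i (bistar k m)"
proof -
  have vw: "v \<in> nbhd N c i w" "v \<noteq> w" "w < N" "c {v, w} = i"
    using w assms(3) by (auto simp: nbhd_def insert_commute)
  have "k - 1 \<le> card (nbhd N c i v - {w})"
    using v_deg w assms(2) by simp
  then obtain A where A: "A \<subseteq> nbhd N c i v - {w}" "card A = k - 1"
    by (metis obtain_subset_with_card_n)
  then have "finite A"
    by (meson finite_nbhd finite_Diff finite_subset)
  \<comment> \<open>Discarding \<open>v\<close> and the \<open>k - 1\<close> vertices of
    \<open>A\<close> leaves at least (k + m - 1) - 1 - (k - 1) = m - 1 candidates, just enough for
    \<open>B\<close>.\<close>
  have "card (nbhd N c i w - {v}) - card A \<le> card (nbhd N c i w - {v} - A)"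
    by (rule diff_card_le_card_Diff) fact
  then have "m - 1 \<le> card (nbhd N c i w - {v} - A)"
    using w_deg vw(1) A assms(1,2) by simp
  then obtain B where B: "B \<subseteq> nbhd N c i w - {v} - A" "card B = m - 1"
    by (metis obtain_subset_with_card_n)
  then have "finite B"
    by (meson finite_nbhd finite_Diff finite_subset)
  obtain g where g: "bij_betw g {2..k} A"
    using finite_same_card_bij[of "{2..k}" A] A \<open>finite A\<close> by auto
  obtain h where h: "bij_betw h {k + 1..<k + m} B"
    using finite_same_card_bij[of "{k + 1..<k + m}" B] B \<open>finite B\<close> by auto
  \<comment> \<open>The cases follow the vertex numbering of \<open>bistar\<close>. The spine ends 0
    and 1 are tested first because both also satisfy \<open>j \<le> k\<close>.\<close>
  define f where "f j = (if j = 0 then v else if j = 1 then w else if j \<le> k then g j else h j)" for j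
  have f01: "f 0 = v" "f 1 = w"
    by (auto simp: f_def)
  have fA: "bij_betw f {2..k} A"
    using g bij_betw_cong[of "{2..k}" f g A] by (simp add: f_def)
  have fB: "bij_betw f {k + 1..<k + m} B"
    using h assms(1) bij_betw_cong[of "{k + 1..<k + m}" f h B] by (simp add: f_def)
  \<comment> \<open>The two bijections glue because \<open>B\<close> was chosen disjoint from
    \<open>A\<close>.\<close>
  have "bij_betw f ({2..k} \<union> {k + 1..<k + m}) (A \<union> B)"
    using fA fB B by (intro bij_betw_combine) auto
  moreover have "v \<notin> A \<union> B" "w \<notin> A \<union> B"
    using A B by (auto simp: nbhd_def)
  moreover have "{..<k + m} = insert 0 (insert 1 ({2..k} \<union> {k + 1..<k + m}))"
    using assms(1,2) by auto
  ultimately have "inj_on f {..<k + m}" "f ` {..<k + m} = insert v (insert w (A \<union> B))"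
    using f01 vw(2) by (auto simp: bij_betw_def)
  moreover have "insert v (insert w (A \<union> B)) \<subseteq> {..<N}"
    using A B vw assms(3) by (auto simp: nbhd_def)
  moreover have "c (f ` {0, j}) = i" if "j \<in> {2..k}" for j
  proof -
    have "f j \<in> A"
      using fA that by (auto simp: bij_betw_def)
    then show ?thesis
      using A f01 by (auto simp: nbhd_def)
  qed
  moreover have "c (f ` {1, j}) = i" if "j \<in> {k + 1..<k + m}" for j
  proof -
    have "f j \<in> B"
      using fB that by (auto simp: bij_betw_def)
    then show ?thesis
      using B f01 by (auto simp: nbhd_def)
  qed
  moreover have "c (f ` {0, 1}) = i"
    using f01 vw by simp
  ultimately show ?thesis
    unfolding mono_copy_def bistar_def fst_conv snd_conv by (intro exI[of _ f]) blast
qed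

lemma arrows_bistar_star:
  assumes "k \<ge> 1" "m \<ge> 1" "n \<ge> 1"
  shows "arrows (k + m + n - 1) (bistar k m) (star n)"
  unfolding arrows_def
proof (intro allI)
  fix c
  let ?N = "k + m + n - 1"
  show "mono_copy ?N c Red (bistar k m) \<or> mono_copy ?N c Blue (star n)"
  proof (rule disjCI)
    assume no_star: "\<not> mono_copy ?N c Blue (star n)"
    have deg: "k + m - 1 \<le> card (nbhd ?N c Red x)" if "x < ?N" for x
    proof -
      \<comment> \<open>With at most n - 1 blue edges at \<open>x\<close>, at least (k + m + n - 2)
        - (n - 1) = k + m - 1 of its edges are red.\<close>
      have "card (nbhd ?N c Blue x) < n"
        using mono_copy_star[OF that] no_star by (meson not_less)
      then show ?thesis
        using card_nbhd_Red_plus_Blue[OF that, of c] by linarith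
    qed
    have "0 < ?N"
      using assms by linarith
    \<comment> \<open>Since k + m - 1 \<ge> 1, a red edge exists at every vertex; the one taken as
      spine starts at vertex 0.\<close>
    then have "0 < card (nbhd ?N c Red 0)"
      using deg[of 0] assms by linarith
    then obtain w where w: "w \<in> nbhd ?N c Red 0"
      by (auto simp: card_gt_0_iff)
    then have "w < ?N"
      by (auto simp: nbhd_def)
    with w \<open>0 < ?N\<close> show "mono_copy ?N c Red (bistar k m)"
      using assms deg by (intro mono_copy_bistar[of k m 0 ?N w]) auto
  qed
qed

theorem theorem2:
  fixes k m n :: nat
  assumes "k \<ge> 1" "m \<ge> 1" "n \<ge> 1"
  shows "ramsey_number (bistar k m) (star n) \<le> k + m + n - 1"
  unfolding ramsey_number_def by (intro Least_le arrows_bistar_star assms)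

end
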